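(* Let $w>0$ be a window size and $M>0$ the available memory (in bits). For the Short Hash Filter (SHF) with these parameters, the false negative probability is $0$ and the false positive probability is $1-\left(1-\sqrt{w\,2^{-M/w}}\right)^w$. For the Compact Short Hash Filter (CSHF) with these parameters, the false negative probability is $0$ and the false positive probability is $1-\left(1-2^{-M/w}\right)^w$.
   Context: A stream $E=(e_1,e_2,\dots)$ has elements in an alphabet $\Gamma$; a new element $e^\star$ arriving after $e_1,\dots,e_n$ is a duplicate over the sliding window $w$ if $e^\star\in\{e_{n-w+1},\dots,e_n\}$, and unseen otherwise. A filter outputs $\mathrm{DUPLICATE}$ or $\mathrm{UNSEEN}$ for each new element and then inserts it. The false positive probability is the probability that an unseen element is classified $\mathrm{DUPLICATE}$; the false negative probability is the probability that a duplicate is classified $\mathrm{UNSEEN}$; both are considered in the stationary regime (after at least $w$ insertions). Hash functions are modeled as uniformly random. SHF: uses a hash function $h$ with outputs of $\frac{M}{2w}-\frac12\log_2 w$ bits, a FIFO queue $Q$ of the hashes of the last $w$ inserted elements, and a dictionary $D$ mapping hash values to counters; insertion of $e$ pushes $h(e)$ on $Q$ and increments $D[h(e)]$, and if $Q$ has more than $w$ entries it pops the oldest hash $h'$, decrements $D[h']$ and deletes the key if the counter reaches $0$; lookup of $e$ returns $\mathrm{DUPLICATE}$ iff $D[h(e)]>0$. CSHF: a FIFO queue of the hashes $h(e)$ of the last $w$ inserted elements with $h$ a hash function with outputs of $\frac{M}{w}$ bits, without dictionary; lookup returns $\mathrm{DUPLICATE}$ iff $h(e)$ is in the queue. (Integer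 rounding of hash lengths is ignored.)
   Formalization: The false positive formulas are stated for windows whose w elements are pairwise distinct (with repeats a random hash gives exponent d < w, the number of distinct elements), and for M such that the number of hash values is an integer; false negatives are covered for all streams. *)

theory Defs
  imports "HOL-Probability.Probability"
begin

datatype verdict = DUPLICATE | UNSEEN

record ('e, 's) stream_filter =
  initial :: 's
  insertion :: "'e \<Rightarrow> 's \<Rightarrow> 's"
  lookup :: "'e \<Rightarrow> 's \<Rightarrow> verdict"

text \<open>Streams are functions \<open>E\<close> on \<open>nat\<close> read from index 1 on; \<open>E 0\<close> is never used.\<close>

definition state_after :: "('e, 's) stream_filter \<Rightarrow> (nat \<Rightarrow> 'e) \<Rightarrow> nat \<Rightarrow> 's" where
  "state_after F E n = fold (insertion F) (map E [1..<n + 1]) (initial F)"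

definition classify :: "('e, 's) stream_filter \<Rightarrow> (nat \<Rightarrow> 'e) \<Rightarrow> nat \<Rightarrow> 'e \<Rightarrow> verdict" where
  "classify F E n x = lookup F x (state_after F E n)"

text \<open>By truncated subtraction the window is \<open>{1..n}\<close> as long as \<open>n < w\<close>.\<close>

definition window :: "nat \<Rightarrow> nat \<Rightarrow> nat set" where
  "window w n = {n - w + 1..n}"

definition is_duplicate :: "nat \<Rightarrow> (nat \<Rightarrow> 'e) \<Rightarrow> nat \<Rightarrow> 'e \<Rightarrow> bool" where
  "is_duplicate w E n x \<longleftrightarrow> x \<in> E ` window w n"

fun shf_insert :: "nat \<Rightarrow> ('e \<Rightarrow> 'h) \<Rightarrow> 'e \<Rightarrow> 'h list \<times> ('h \<rightharpoonup> nat) \<Rightarrow> 'h list \<times> ('h \<rightharpoonup> nat)" where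
  "shf_insert w h e (Q, D) =
    (let Q1 = Q @ [h e];
         D1 = D(h e \<mapsto> (case D (h e) of None \<Rightarrow> 1 | Some c \<Rightarrow> c + 1))
     in if length Q1 > w
        then (let h' = hd Q1; c = the (D1 h') - 1
              in (tl Q1, if c = 0 then D1(h' := None) else D1(h' \<mapsto> c)))
        else (Q1, D1))"

fun shf_lookup :: "('e \<Rightarrow> 'h) \<Rightarrow> 'e \<Rightarrow> 'h list \<times> ('h \<rightharpoonup> nat) \<Rightarrow> verdict" where
  "shf_lookup h e (Q, D) =
    (case D (h e) of None \<Rightarrow> UNSEEN | Some c \<Rightarrow> if c > 0 then DUPLICATE else UNSEEN)"

definition SHF :: "nat \<Rightarrow> ('e \<Rightarrow> 'h) \<Rightarrow> ('e, 'h list \<times> ('h \<rightharpoonup> nat)) stream_filter" where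
  "SHF w h = \<lparr>initial = ([], Map.empty), insertion = shf_insert w h, lookup = shf_lookup h\<rparr>"

definition cshf_insert :: "nat \<Rightarrow> ('e \<Rightarrow> 'h) \<Rightarrow> 'e \<Rightarrow> 'h list \<Rightarrow> 'h list" where
  "cshf_insert w h e Q = (let Q1 = Q @ [h e] in if length Q1 > w then tl Q1 else Q1)"

definition cshf_lookup :: "('e \<Rightarrow> 'h) \<Rightarrow> 'e \<Rightarrow> 'h list \<Rightarrow> verdict" where
  "cshf_lookup h e Q = (if h e \<in> set Q then DUPLICATE else UNSEEN)"

definition CSHF :: "nat \<Rightarrow> ('e \<Rightarrow> 'h) \<Rightarrow> ('e, 'h list) stream_filter" where
  "CSHF w h = \<lparr>initial = [], insertion = cshf_insert w h, lookup = cshf_lookup h\<rparr>"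

text \<open>The number of bits \<open>b\<close> may be any real such that \<open>2 powr b\<close> is the number of hash values;
  bit strings of length \<open>b\<close> are the case of a natural \<open>b\<close>.\<close>

definition hash_values_of_bits :: "'h set \<Rightarrow> real \<Rightarrow> bool" where
  "hash_values_of_bits H b \<longleftrightarrow> finite H \<and> real (card H) = 2 powr b"

text \<open>Law of a uniformly random function from \<open>\<Gamma>\<close> to \<open>H\<close>: independent uniform values.
  The alphabet may be infinite.\<close>

definition random_hash :: "'e set \<Rightarrow> 'h set \<Rightarrow> ('e \<Rightarrow> 'h) measure" where
  "random_hash \<Gamma> H = PiM \<Gamma> (\<lambda>_. uniform_count_measure H)"

definition verdict_probability ::
  "'e set \<Rightarrow> 'h set \<Rightarrow> (('e \<Rightarrow> 'h) \<Rightarrow> ('e, 's) stream_filter) \<Rightarrow> (nat \<Rightarrow> 'e) \<Rightarrow> nat \<Rightarrow> 'e \<Rightarrow> verdict \<Rightarrow> real" where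
  "verdict_probability \<Gamma> H F E n x v =
    measure (random_hash \<Gamma> H) {h \<in> space (random_hash \<Gamma> H). classify (F h) E n x = v}"

text \<open>The two error probabilities after \<open>n\<close> insertions, for a new element \<open>x\<close> that is unseen,
  respectively a duplicate.\<close>

abbreviation false_positive_probability where
  "false_positive_probability \<Gamma> H F E n x \<equiv> verdict_probability \<Gamma> H F E n x DUPLICATE"

abbreviation false_negative_probability where
  "false_negative_probability \<Gamma> H F E n x \<equiv> verdict_probability \<Gamma> H F E n x UNSEEN"

end

theory Submission imports Defs begin

text \<open>After any number of insertions both filters answer \<open>DUPLICATE\<close> exactly when \<open>h x\<close> is the
  hash of an element of the window. Hence there are no false negatives. For an unseen \<open>x\<close> and
  a window of \<open>w\<close> distinct elements, condition on the value of \<open>h x\<close>: by independence each of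
  the \<open>w\<close> hashes avoids it with probability \<open>1 - 1 / N\<close>, where \<open>N\<close> is the number of hash
  values.\<close>

section \<open>Contents of the FIFO queue after \<open>n\<close> insertions\<close>

lemma state_after_0: "state_after F E 0 = initial F"
  by (simp add: state_after_def)

lemma state_after_Suc: "state_after F E (Suc n) = insertion F (E (Suc n)) (state_after F E n)"
  by (simp add: state_after_def)

text \<open>Closed form of the queue, oldest hash first. Truncated subtraction makes it start at
  index 1 while the queue is still filling up.\<close>

definition window_hashes :: "nat \<Rightarrow> ('e \<Rightarrow> 'h) \<Rightarrow> (nat \<Rightarrow> 'e) \<Rightarrow> nat \<Rightarrow> 'h list" where
  "window_hashes w h E n = map (\<lambda>i. h (E i)) [n - w + 1..<n + 1]"

lemma window_hashes_0: "window_hashes w h E 0 = []"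
  by (simp add: window_hashes_def)

lemma length_window_hashes: "length (window_hashes w h E n) = min n w"
  by (auto simp: window_hashes_def)

lemma set_window_hashes: "set (window_hashes w h E n) = h ` E ` window w n"
  by (auto simp: window_hashes_def window_def image_image)

text \<open>The closed form obeys the push-and-pop recursion: while \<open>n < w\<close> the lower
  index stays at 1, afterwards it moves up by one, which drops the head.\<close>

lemma window_hashes_Suc:
  assumes "w > 0"
  shows "window_hashes w h E (Suc n) =
    (let Q = window_hashes w h E n @ [h (E (Suc n))] in if length Q > w then tl Q else Q)"
proof (cases "n < w")
  case True
  then show ?thesis
    by (simp add: window_hashes_def Let_def)
next
  case False
  \<comment> \<open>The second fact makes the old index range nonempty, so its first index can be
    split off.\<close>
  then have "Suc n - w = Suc (n - w)" and "Suc (n - w) < Suc n"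
    using assms by auto
  moreover from this have "[Suc (n - w)..<Suc n] = Suc (n - w) # [Suc (Suc (n - w))..<Suc n]"
    by (simp only: upt_conv_Cons)
  ultimately have "window_hashes w h E (Suc n) = tl (window_hashes w h E n @ [h (E (Suc n))])"
    by (simp add: window_hashes_def del: upt_Suc) simp
  then show ?thesis
    using False by (simp add: length_window_hashes Let_def)
qed

lemma state_after_CSHF:
  assumes "w > 0"
  shows "state_after (CSHF w h) E n = window_hashes w h E n"
proof (induction n)
  case 0
  then show ?case
    by (simp add: state_after_0 window_hashes_0 CSHF_def)
next
  case (Suc n)
  then show ?case
    using assms by (simp add: state_after_Suc window_hashes_Suc CSHF_def cshf_insert_def)
qed

section \<open>The dictionary of SHF as a function of its queue\<close>

definition multiplicities :: "'h list \<Rightarrow> 'h \<rightharpoonup> nat" where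
  "multiplicities Q k = (if k \<in> set Q then Some (count_list Q k) else None)"

lemma multiplicities_Nil: "multiplicities [] = Map.empty"
  by (simp add: multiplicities_def fun_eq_iff)

lemma multiplicities_snoc:
  "multiplicities (Q @ [a]) =
    (multiplicities Q)(a \<mapsto> (case multiplicities Q a of None \<Rightarrow> 1 | Some c \<Rightarrow> c + 1))"
  by (auto simp: multiplicities_def fun_eq_iff)

text \<open>Popping lowers the count of the head by one. It reaches 0 exactly when the head does not
  recur in the tail, and then \<open>multiplicities\<close> has no key for it.\<close>

lemma multiplicities_tl:
  assumes "Q \<noteq> []"
  shows "multiplicities (tl Q) =
    (let c = the (multiplicities Q (hd Q)) - 1
     in if c = 0 then (multiplicities Q)(hd Q := None) else (multiplicities Q)(hd Q \<mapsto> c))"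
  using assms
  by (cases Q) (auto simp: multiplicities_def fun_eq_iff Let_def count_list_0_iff)

text \<open>Invariant that reduces SHF to CSHF: both run the same queue, and the dictionary stays
  determined by it.\<close>

lemma shf_insert_multiplicities:
  "shf_insert w h e (Q, multiplicities Q) =
    (let Q' = cshf_insert w h e Q in (Q', multiplicities Q'))"
proof (cases "length (Q @ [h e]) > w")
  case True
  then show ?thesis
    by (simp add: cshf_insert_def Let_def multiplicities_tl multiplicities_snoc del: length_append)
next
  case False
  then show ?thesis
    by (simp add: cshf_insert_def Let_def multiplicities_snoc)
qed

lemma state_after_SHF:
  assumes "w > 0"
  shows "state_after (SHF w h) E n =
    (window_hashes w h E n, multiplicities (window_hashes w h E n))"
proof (induction n)
  case 0
  then show ?case
    by (simp add: state_after_0 window_hashes_0 SHF_def multiplicities_Nil)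
next
  case (Suc n)
  have "cshf_insert w h (E (Suc n)) (window_hashes w h E n) = window_hashes w h E (Suc n)"
    using assms by (simp add: window_hashes_Suc cshf_insert_def)
  then show ?case
    using Suc by (simp add: state_after_Suc SHF_def shf_insert_multiplicities Let_def del: shf_insert.simps)
qed

section \<open>Verdicts in terms of the window\<close>

lemma classify_CSHF:
  assumes "w > 0"
  shows "classify (CSHF w h) E n x = (if h x \<in> h ` E ` window w n then DUPLICATE else UNSEEN)"
proof -
  have "lookup (CSHF w h) = cshf_lookup h"
    by (simp add: CSHF_def)
  then show ?thesis
    by (simp add: classify_def state_after_CSHF[OF assms] cshf_lookup_def set_window_hashes)
qed

lemma classify_SHF:
  assumes "w > 0"
  shows "classify (SHF w h) E n x = (if h x \<in> h ` E ` window w n then DUPLICATE else UNSEEN)"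
proof -
  have "lookup (SHF w h) = shf_lookup h"
    by (simp add: SHF_def)
  \<comment> \<open>Stored counters are positive, so looking up a counter amounts to membership in
    the queue.\<close>
  moreover have "shf_lookup h x (Q, multiplicities Q) = (if h x \<in> set Q then DUPLICATE else UNSEEN)"
    for Q
    using count_list_0_iff[of Q "h x"] by (auto simp: multiplicities_def)
  ultimately show ?thesis
    by (simp add: classify_def state_after_SHF[OF assms] set_window_hashes del: shf_lookup.simps)
qed

section \<open>Collision probability of a uniformly random hash\<close>

lemma prob_space_random_hash:
  assumes "finite H" and "H \<noteq> {}"
  shows "prob_space (random_hash \<Gamma> H)"
  unfolding random_hash_def
  using assms by (intro prob_space_PiM prob_space_uniform_count_measure)

text \<open>The event is split by the value \<open>k\<close> of \<open>h x\<close>. For finite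
  \<open>Y\<close> each piece restricts finitely many coordinates, so its product measure can be
  computed even over an infinite alphabet.\<close>

lemma no_collision_cylinders:
  fixes x :: 'e and H :: "'h set"
  defines "X \<equiv> \<lambda>k y. if y = x then {k} else H - {k}"
  assumes "x \<in> \<Gamma>" and "Y \<subseteq> \<Gamma>" and "x \<notin> Y"
  shows "{h \<in> space (random_hash \<Gamma> H). h x \<notin> h ` Y} =
    (\<Union>k\<in>H. prod_emb \<Gamma> (\<lambda>_. uniform_count_measure H) (insert x Y) (\<Pi>\<^sub>E y\<in>insert x Y. X k y))"
    (is "?L = ?R")
proof (intro subset_antisym subsetI)
  fix h assume "h \<in> ?L"
  then show "h \<in> ?R"
    using assms
    by (auto simp: random_hash_def space_PiM prod_emb_def space_uniform_count_measure PiE_iff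
        intro!: bexI[of _ "h x"]) (metis imageI)
next
  fix h assume "h \<in> ?R"
  then obtain k where k: "\<forall>y\<in>insert x Y. h y \<in> X k y" and h: "h \<in> space (random_hash \<Gamma> H)"
    by (auto simp: random_hash_def space_PiM prod_emb_def PiE_iff)
  have "h x = k" and "\<forall>y\<in>Y. h y \<noteq> k"
    using k \<open>x \<notin> Y\<close> by (auto simp: X_def split: if_splits)
  then show "h \<in> ?L"
    using h by auto
qed

lemma
  fixes x :: 'e and H :: "'h set"
  assumes "finite H" and "H \<noteq> {}" and "x \<in> \<Gamma>" and "Y \<subseteq> \<Gamma>" and "finite Y" and "x \<notin> Y"
  shows sets_no_collision:
      "{h \<in> space (random_hash \<Gamma> H). h x \<notin> h ` Y} \<in> sets (random_hash \<Gamma> H)" (is ?meas)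
    and prob_no_collision:
      "measure (random_hash \<Gamma> H) {h \<in> space (random_hash \<Gamma> H). h x \<notin> h ` Y} =
        (1 - 1 / real (card H)) ^ card Y" (is ?prob)
proof -
  let ?U = "\<lambda>_ :: 'e. uniform_count_measure H"
  define X where "X = (\<lambda>k y. if y = x then {k} else H - {k})"
  define C where "C = (\<lambda>k. prod_emb \<Gamma> ?U (insert x Y) (\<Pi>\<^sub>E y\<in>insert x Y. X k y))"
  interpret prob_space "random_hash \<Gamma> H"
    using assms by (intro prob_space_random_hash)
  interpret P: product_prob_space ?U \<Gamma>
    using assms by (intro product_prob_spaceI prob_space_uniform_count_measure)
  have N: "real (card H) > 0"
    using assms by (simp add: card_gt_0_iff)
  have decomp: "{h \<in> space (random_hash \<Gamma> H). h x \<notin> h ` Y} = (\<Union>k\<in>H. C k)"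
    unfolding C_def X_def using assms by (intro no_collision_cylinders)
  have X: "X k y \<in> sets (?U y)" if "k \<in> H" for k y
    using that by (auto simp: X_def sets_uniform_count_measure)
  have C: "C k \<in> sets (random_hash \<Gamma> H)" if "k \<in> H" for k
    unfolding C_def random_hash_def using assms X[OF that]
    by (intro sets_PiM_I) auto
  show ?meas
    unfolding decomp using C assms by (intro sets.finite_UN) auto
  have prob_C: "prob (C k) = 1 / card H * (1 - 1 / card H) ^ card Y" if k: "k \<in> H" for k
  proof -
    have "prob (C k) = (\<Prod>y\<in>insert x Y. measure (?U y) (X k y))"
      unfolding C_def random_hash_def using assms X[OF k] by (intro P.measure_PiM_emb) auto
    also have "\<dots> = measure (?U x) {k} * (\<Prod>y\<in>Y. measure (?U y) (H - {k}))"
    proof -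
      have "(\<Prod>y\<in>Y. measure (?U y) (X k y)) = (\<Prod>y\<in>Y. measure (?U y) (H - {k}))"
        using assms by (intro prod.cong) (auto simp: X_def)
      then show ?thesis
        using assms by (simp add: X_def)
    qed
    also have "\<dots> = 1 / card H * ((card H - 1) / card H) ^ card Y"
      \<comment> \<open>As \<open>H\<close> is nonempty, the natural subtraction in the cardinality
        of \<open>H - {k}\<close> does not truncate.\<close>
      using assms k N by (simp add: measure_uniform_count_measure of_nat_diff Suc_le_eq)
    also have "(card H - 1) / card H = 1 - 1 / card H"
      using N by (simp add: field_simps)
    finally show ?thesis .
  qed
  \<comment> \<open>Cylinders for different \<open>k\<close> prescribe different values at
    \<open>x\<close>.\<close>
  have "disjoint_family_on C H"
    by (fastforce simp: disjoint_family_on_def C_def X_def prod_emb_def PiE_iff)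
  then have "prob (\<Union>k\<in>H. C k) = (\<Sum>k\<in>H. prob (C k))"
    using assms C by (intro finite_measure_finite_Union) auto
  \<comment> \<open>The \<open>card H\<close> equal summands cancel the factor
    \<open>1 / card H\<close>.\<close>
  also have "\<dots> = (1 - 1 / card H) ^ card Y"
    using N by (simp add: prob_C)
  finally show ?prob
    by (simp add: decomp)
qed

section \<open>Error probabilities of both filters\<close>

lemma false_negative_probability_eq_0:
  assumes "\<And>h. classify (F h) E n x = (if h x \<in> h ` E ` window w n then DUPLICATE else UNSEEN)"
    and "is_duplicate w E n x"
  shows "false_negative_probability \<Gamma> H F E n x = 0"
  \<comment> \<open>The event is empty, not merely null: the hash of a duplicate is in the window
    under every \<open>h\<close>.\<close>
  using assms by (simp add: verdict_probability_def is_duplicate_def)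

lemma false_positive_probability_eq:
  assumes classify: "\<And>h. classify (F h) E n x =
      (if h x \<in> h ` E ` window w n then DUPLICATE else UNSEEN)"
    and H: "finite H" "H \<noteq> {}"
    and E: "\<And>i. i \<ge> 1 \<Longrightarrow> E i \<in> \<Gamma>" "inj_on E (window w n)"
    and x: "x \<in> \<Gamma>" "\<not> is_duplicate w E n x"
    and "n \<ge> w"
  shows "false_positive_probability \<Gamma> H F E n x = 1 - (1 - 1 / real (card H)) ^ w"
proof -
  interpret prob_space "random_hash \<Gamma> H"
    using H by (rule prob_space_random_hash)
  let ?Y = "E ` window w n"
  let ?A = "{h \<in> space (random_hash \<Gamma> H). h x \<notin> h ` ?Y}"
  \<comment> \<open>The window has \<open>w\<close> positions because \<open>n \<ge> w\<close>, all
    at least 1, and injectivity turns them into \<open>w\<close> distinct elements.\<close>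
  have Y: "?Y \<subseteq> \<Gamma>" "finite ?Y" "x \<notin> ?Y" "card ?Y = w"
    using E x \<open>n \<ge> w\<close> by (auto simp: window_def is_duplicate_def card_image)
  have "false_positive_probability \<Gamma> H F E n x = prob (space (random_hash \<Gamma> H) - ?A)"
    unfolding verdict_probability_def classify by (rule arg_cong[where f = prob]) auto
  also have "\<dots> = 1 - prob ?A"
    using sets_no_collision[OF H x(1) Y(1-3)] by (rule prob_compl)
  also have "prob ?A = (1 - 1 / real (card H)) ^ w"
    using prob_no_collision[OF H x(1) Y(1-3)] Y(4) by simp
  finally show ?thesis .
qed

lemma hash_values_of_bitsD:
  assumes "hash_values_of_bits H b"
  shows "finite H" and "H \<noteq> {}" and "1 / real (card H) = 2 powr (- b)"
  using assms by (auto simp: hash_values_of_bits_def powr_minus_divide)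

text \<open>The SHF hash length is half of \<open>M / w - log 2 w\<close>; halving the exponent is
  taking the square root.\<close>

lemma inverse_card_SHF_hashes:
  fixes w M :: real
  assumes "w > 0"
  shows "2 powr (- (M / (2 * w) - 1 / 2 * log 2 w)) = sqrt (w * 2 powr (- M / w))"
proof -
  have "w * 2 powr (- M / w) = 2 powr (log 2 w + - M / w)"
    using assms by (simp only: powr_add) simp
  then have "sqrt (w * 2 powr (- M / w)) = 2 powr ((log 2 w + - M / w) * (1 / 2))"
    by (simp add: powr_half_sqrt[symmetric] powr_powr)
  also have "(log 2 w + - M / w) * (1 / 2) = - (M / (2 * w) - 1 / 2 * log 2 w)"
    by (simp add: field_simps)
  finally show ?thesis
    by simp
qed

text \<open>Stationarity is \<open>n \<ge> w\<close>. The false positive formulas are stated for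
  windows without repetitions, since the exponent counts the distinct elements, whose hashes are
  independent.\<close>

theorem theorem3:
  fixes w n :: nat and M :: real and \<Gamma> :: "'e set" and E :: "nat \<Rightarrow> 'e"
    and H :: "'h set" and K :: "'k set"
  assumes "w > 0" and "M > 0"
    and "\<And>i. i \<ge> 1 \<Longrightarrow> E i \<in> \<Gamma>"
    and "n \<ge> w"
  shows "(hash_values_of_bits H (M / (2 * w) - 1 / 2 * log 2 w) \<longrightarrow>
      (\<forall>x\<in>\<Gamma>. is_duplicate w E n x \<longrightarrow>
         false_negative_probability \<Gamma> H (SHF w) E n x = 0) \<and>
      (inj_on E (window w n) \<longrightarrow> (\<forall>x\<in>\<Gamma>. \<not> is_duplicate w E n x \<longrightarrow>
         false_positive_probability \<Gamma> H (SHF w) E n x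
           = 1 - (1 - sqrt (w * 2 powr (- M / w))) ^ w))) \<and>
    (hash_values_of_bits K (M / w) \<longrightarrow>
      (\<forall>x\<in>\<Gamma>. is_duplicate w E n x \<longrightarrow>
         false_negative_probability \<Gamma> K (CSHF w) E n x = 0) \<and>
      (inj_on E (window w n) \<longrightarrow> (\<forall>x\<in>\<Gamma>. \<not> is_duplicate w E n x \<longrightarrow>
         false_positive_probability \<Gamma> K (CSHF w) E n x
           = 1 - (1 - 2 powr (- M / w)) ^ w)))"
proof (intro conjI impI ballI)
  fix x assume "is_duplicate w E n x"
  then show "false_negative_probability \<Gamma> H (SHF w) E n x = 0"
    and "false_negative_probability \<Gamma> K (CSHF w) E n x = 0"
    using \<open>w > 0\<close> by (auto intro!: false_negative_probability_eq_0 classify_SHF classify_CSHF)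
next
  fix x
  assume "hash_values_of_bits H (M / (2 * w) - 1 / 2 * log 2 w)"
    and x: "inj_on E (window w n)" "x \<in> \<Gamma>" "\<not> is_duplicate w E n x"
  note H = hash_values_of_bitsD[OF this(1)]
  have "false_positive_probability \<Gamma> H (SHF w) E n x = 1 - (1 - 1 / real (card H)) ^ w"
    using \<open>w > 0\<close> by (intro false_positive_probability_eq classify_SHF H x assms(3,4))
  then show "false_positive_probability \<Gamma> H (SHF w) E n x
      = 1 - (1 - sqrt (w * 2 powr (- M / w))) ^ w"
    using \<open>w > 0\<close> inverse_card_SHF_hashes[of "real w" M] by (simp add: H(3))
next
  fix x
  assume "hash_values_of_bits K (M / w)"
    and x: "inj_on E (window w n)" "x \<in> \<Gamma>" "\<not> is_duplicate w E n x"
  note K = hash_values_of_bitsD[OF this(1)]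
  have "false_positive_probability \<Gamma> K (CSHF w) E n x = 1 - (1 - 1 / real (card K)) ^ w"
    using \<open>w > 0\<close> by (intro false_positive_probability_eq classify_CSHF K x assms(3,4))
  then show "false_positive_probability \<Gamma> K (CSHF w) E n x = 1 - (1 - 2 powr (- M / w)) ^ w"
    by (simp add: K(3))
qed

end
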